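(* Consider the linear model $\boldsymbol{Y} = \boldsymbol{X}\boldsymbol{\beta} + \boldsymbol{\epsilon}$ with $\boldsymbol{X}$ a real $(n\times k)$ matrix of rank $k \le n$ and $\boldsymbol{\epsilon}$ a random vector with zero-mean, homoscedastic and uncorrelated components, let $Q(\boldsymbol{\beta}) = (\boldsymbol{Y}-\boldsymbol{X}\boldsymbol{\beta})'(\boldsymbol{Y}-\boldsymbol{X}\boldsymbol{\beta})$, and fix $c>0$. Let $\widehat{\boldsymbol{\beta}}_{c}\in\mathbb{R}^k$ be the constrained solution satisfying, together with a scalar $\widehat{\lambda}$, the $k+1$ equations $(\boldsymbol{X}'\boldsymbol{X}+\lambda \boldsymbol{I}_k)\boldsymbol{\beta} = \boldsymbol{X}'\boldsymbol{Y}$ and $\boldsymbol{\beta}'\boldsymbol{\beta} = c^2$ in the $k+1$ unknowns $(\beta_1,\ldots,\beta_k,\lambda)$. Let $\widehat{\boldsymbol{\beta}}_{0}\in\mathbb{R}^k$ minimize $Q(\boldsymbol{\beta})$ subject to $\boldsymbol{\beta}'\boldsymbol{\beta}\le c^2$, and let $\mu_0(\cdot)$ be the probability measure of $\widehat{\boldsymbol{\beta}}_{0}$ on $\mathbb{R}^k$. Then, with the measures $\mu$, $\mu_{S_c}$, $\mu_{B_c}$ and the open ball $B_c$ as defined in the context: (i) The joint distribution $\mathcal{L}(\widehat{\boldsymbol{\beta}}_{c})$, corresponding to $\mu_{S_c}(\cdot)$, is singular on $\mathbb{R}^k$ of rank $k-1$. (ii) The measure $\mu_0(\cdot)$ of $\widehat{\boldsymbol{\beta}}_{0}$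 admits the mixture representation $$\mu_0(A) = \alpha\,\mu_{B_c}(A) + \bar{\alpha}\,\mu_{S_c}(A)$$ for measurable $A\subset\mathbb{R}^k$, with mixing probabilities $\alpha = 1-\bar{\alpha}\in(0,1)$, such that: (iii) $\mu_{B_c}(A) = [\mu(B_c)]^{-1}\int_A I_{B_c}(\boldsymbol{t})\,d\mu(\boldsymbol{t})$, where $I_{B_c}$ is the indicator function of $B_c$; and (iv) $\alpha = \mu(B_c)$.
   Context: A prime denotes transpose and $\boldsymbol{I}_k$ is the $(k\times k)$ identity matrix. The ordinary least squares estimator is $\widehat{\boldsymbol{\beta}}_{L} = (\boldsymbol{X}'\boldsymbol{X})^{-1}\boldsymbol{X}'\boldsymbol{Y}$, the minimizer of $Q$ over $\mathbb{R}^k$. $\mathcal{L}(\cdot)$ denotes the law (probability distribution) of a random vector, and $\mathcal{L}(\cdot\mid\cdot)$ a conditional law. The constrained solution $\widehat{\boldsymbol{\beta}}_{c}$ is the Lagrange solution minimizing $Q(\boldsymbol{\beta})$ subject to the equality constraint $\boldsymbol{\beta}'\boldsymbol{\beta} = c^2$; it satisfies $\widehat{\boldsymbol{\beta}}_{c}'\widehat{\boldsymbol{\beta}}_{c}=c^2$. The inequality-constrained solution $\widehat{\boldsymbol{\beta}}_{0}$ equals $\widehat{\boldsymbol{\beta}}_{L}$ when $\widehat{\boldsymbol{\beta}}_{L}'\widehat{\boldsymbol{\beta}}_{L}<c^2$, and otherwise has length $c$. Let $S_c = \{\boldsymbol{u}\in\mathbb{R}^k : \boldsymbol{u}'\boldsymbol{u}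 = c^2\}$ be the sphere and $B_c = \{\boldsymbol{u}\in\mathbb{R}^k : \boldsymbol{u}'\boldsymbol{u} < c^2\}$ the open ball, both of radius $c$. The measures are: - $\mu(\cdot)$ is the probability measure on $\mathbb{R}^k$ induced through $\boldsymbol{Y}\to\widehat{\boldsymbol{\beta}}_{L}$, i.e. the law of $\widehat{\boldsymbol{\beta}}_{L}$; - $\mu_{S_c}(\cdot)$ is the probability measure on $S_c\subset\mathbb{R}^k$ induced through the solutions $\widehat{\boldsymbol{\beta}}_{c}$ of the two displayed constraint equations; - $\mu_{B_c}(\cdot)$ is the nonsingular probability measure on $B_c\subset\mathbb{R}^k$ induced through the conditional law $\mathcal{L}(\widehat{\boldsymbol{\beta}}_{L}\mid \widehat{\boldsymbol{\beta}}_{L}'\widehat{\boldsymbol{\beta}}_{L}<c^2)$. "Singular on $\mathbb{R}^k$ of rank $k-1$" means that the distribution is concentrated on a $(k-1)$-dimensional subset of $\mathbb{R}^k$ (of Lebesgue measure zero), here the sphere $S_c$.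
   Formalization: In (ii) μ_{S_c} is the law of β_c conditional on β_L'β_L ≥ c², since with the unconditional law of β_c the mixture fails; (ii)–(iv) assume β_L'β_L < c² and β_L'β_L ≥ c² both have positive probability, since α∈(0,1) does not follow from the error model. *)

theory Defs
  imports "HOL-Probability.Probability"
begin

definition rss :: "real^'k^'n \<Rightarrow> real^'n \<Rightarrow> real^'k \<Rightarrow> real" where
  "rss X y b = (y - X *v b) \<bullet> (y - X *v b)"

definition ols :: "real^'k^'n \<Rightarrow> real^'n \<Rightarrow> real^'k" where
  "ols X y = matrix_inv (transpose X ** X) *v (transpose X *v y)"

definition sphere_c :: "real \<Rightarrow> (real^'k) set" where
  "sphere_c c = {u. u \<bullet> u = c\<^sup>2}"

definition ball_c :: "real \<Rightarrow> (real^'k) set" where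
  "ball_c c = {u. u \<bullet> u < c\<^sup>2}"

definition covariance :: "'w measure \<Rightarrow> ('w \<Rightarrow> real) \<Rightarrow> ('w \<Rightarrow> real) \<Rightarrow> real" where
  "covariance M U V =
     (LINT w|M. (U w - (LINT w'|M. U w')) * (V w - (LINT w'|M. V w')))"

text \<open>The case \<open>s2 = 0\<close> of a degenerate error is deliberately not excluded.\<close>

definition homoscedastic_errors :: "'w measure \<Rightarrow> ('w \<Rightarrow> real^'n) \<Rightarrow> real \<Rightarrow> bool" where
  "homoscedastic_errors M eps s2 \<longleftrightarrow>
     eps \<in> borel_measurable M \<and>
     (\<forall>i. integrable M (\<lambda>w. (eps w $ i)\<^sup>2)) \<and>
     (\<forall>i. (LINT w|M. eps w $ i) = 0) \<and>
     (\<forall>i j. covariance M (\<lambda>w. eps w $ i) (\<lambda>w. eps w $ j) = (if i = j then s2 else 0))"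

text \<open>
  The equations alone have several solutions in general (one for each stationary point of the
  residual sum of squares on the sphere), hence the minimality clause.  Even the minimizer need not
  be unique, so \<open>(b, l)\<close> is characterized rather than defined as a function of \<open>y\<close>.
\<close>

definition constrained_solution ::
    "real^'k^'n \<Rightarrow> real^'n \<Rightarrow> real \<Rightarrow> real^'k \<Rightarrow> real \<Rightarrow> bool" where
  "constrained_solution X y c b l \<longleftrightarrow>
     (transpose X ** X + l *\<^sub>R mat 1) *v b = transpose X *v y \<and>
     b \<bullet> b = c\<^sup>2 \<and>
     is_arg_min (rss X y) (\<lambda>u. u \<bullet> u = c\<^sup>2) b"

definition law :: "'w measure \<Rightarrow> ('w \<Rightarrow> real^'k) \<Rightarrow> (real^'k) measure" where
  "law M Z = distr M borel Z"

definition cond_law ::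
    "'w measure \<Rightarrow> ('w \<Rightarrow> real^'k) \<Rightarrow> ('w \<Rightarrow> bool) \<Rightarrow> (real^'k) measure" where
  "cond_law M Z P = distr (uniform_measure M {w \<in> space M. P w}) borel Z"

definition interior_law ::
    "'w measure \<Rightarrow> ('w \<Rightarrow> real^'k) \<Rightarrow> real \<Rightarrow> (real^'k) measure" where
  "interior_law M bL c = cond_law M bL (\<lambda>w. bL w \<bullet> bL w < c\<^sup>2)"

text \<open>
  The law on the sphere is that of the equality-constrained solution on the event where the
  inequality constraint is active.  The unconditional law of \<open>bc\<close> would not do in the mixture
  representation: already for \<open>k = n = 1\<close>, \<open>X = 1\<close>, the boundary part of the inequality-constrained
  estimator weights the points \<open>c\<close> and \<open>- c\<close> as \<open>P(Y \<ge> c)\<close> to \<open>P(Y \<le> - c)\<close>, the law of \<open>bc\<close> as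
  \<open>P(Y > 0)\<close> to \<open>P(Y < 0)\<close>.
\<close>

definition boundary_law ::
    "'w measure \<Rightarrow> ('w \<Rightarrow> real^'k) \<Rightarrow> ('w \<Rightarrow> real^'k) \<Rightarrow> real \<Rightarrow> (real^'k) measure" where
  "boundary_law M bL bc c = cond_law M bc (\<lambda>w. bL w \<bullet> bL w \<ge> c\<^sup>2)"

definition locally_euclidean :: "nat \<Rightarrow> 'a::euclidean_space set \<Rightarrow> bool" where
  "locally_euclidean d S \<longleftrightarrow>
     (\<forall>x\<in>S. \<exists>U T :: 'a set. openin (top_of_set S) U \<and> x \<in> U \<and>
        subspace T \<and> dim T = d \<and> U homeomorphic T)"

definition singular_of_rank_on ::
    "nat \<Rightarrow> 'a::euclidean_space set \<Rightarrow> 'a measure \<Rightarrow> bool" where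
  "singular_of_rank_on d S N \<longleftrightarrow>
     sets N = sets borel \<and> prob_space N \<and>
     S \<in> null_sets lborel \<and> locally_euclidean d S \<and> (AE x in N. x \<in> S)"

end

theory Submission
  imports Defs
begin

text \<open>
  Everything rests on a pointwise identity.  As \<open>X\<close> is injective, the residual sum of squares is
  that of the least squares estimator plus the squared norm of \<open>X *v (b - ols X y)\<close>
  (lemma \<open>rss_eq_rss_ols_plus\<close>), hence strictly convex.  So it has at most one minimizer on the
  closed ball (\<open>rss_minimizer_unique\<close>).  If the least squares estimator lies in the open ball, it
  is this minimizer.  Otherwise the minimizer lies on the sphere, since on the segment towards the
  least squares estimator the residual sum of squares does not grow; the minimality of
  \<open>bc\<close> on the sphere then makes \<open>bc\<close> minimal on the ball too, so it is the same point
  (\<open>ball_minimizer_cases\<close>).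

  Thus \<open>b0\<close> is \<open>bL\<close> on an event and \<open>bc\<close> on its complement; in particular \<open>b0\<close> is
  measurable.  Splitting its law along this event by total probability yields the mixture, with
  the probability of the event as weight (\<open>measure_law_piecewise\<close>).  Singularity is a
  matter of the sphere alone: it is Lebesgue null, and stereographic projection from the antipode
  of a point maps a neighbourhood of the point onto a hyperplane
  (\<open>locally_euclidean_sphere\<close>).
\<close>

section \<open>The sphere as a null set and a manifold\<close>

lemma inner_self_eq_square_iff:
  fixes u :: "'a::real_inner"
  assumes "c > 0"
  shows "u \<bullet> u = c\<^sup>2 \<longleftrightarrow> norm u = c"
  using assms by (simp add: dot_square_norm)

lemma inner_self_le_square_iff:
  fixes u :: "'a::real_inner"
  assumes "c > 0"
  shows "u \<bullet> u \<le> c\<^sup>2 \<longleftrightarrow> norm u \<le> c"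
  using assms by (simp add: dot_square_norm abs_le_square_iff [symmetric])

lemma inner_self_less_square_iff:
  fixes u :: "'a::real_inner"
  assumes "c > 0"
  shows "u \<bullet> u < c\<^sup>2 \<longleftrightarrow> norm u < c"
  using inner_self_le_square_iff [OF assms, of u] inner_self_eq_square_iff [OF assms, of u]
  by linarith

lemma sphere_c_eq_sphere: "c > 0 \<Longrightarrow> sphere_c c = sphere 0 c"
  by (auto simp: sphere_c_def inner_self_eq_square_iff)

lemma ball_c_eq_ball: "c > 0 \<Longrightarrow> ball_c c = ball 0 c"
  by (auto simp: ball_c_def inner_self_less_square_iff)

text \<open>
  Stereographic projection from the antipode \<open>- x\<close> charts the neighbourhood \<open>sphere 0 c - {- x}\<close>
  of \<open>x\<close>.  In dimension 1 this neighbourhood is \<open>{x}\<close>, and the model space is \<open>{0}\<close>.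
\<close>

lemma locally_euclidean_sphere:
  assumes "c > 0"
  shows "locally_euclidean (DIM('a) - 1) (sphere (0::'a::euclidean_space) c)"
  unfolding locally_euclidean_def
proof
  fix x :: 'a
  assume x: "x \<in> sphere 0 c"
  obtain T :: "'a set" where T: "subspace T" "dim T = DIM('a) - 1"
    using choose_subspace_of_subspace [of "DIM('a) - 1" "UNIV :: 'a set"] by auto
  have "x \<noteq> - x"
    using x assms by (auto simp: eq_neg_iff_add_eq_0 simp flip: scaleR_2)
  moreover have "openin (top_of_set (sphere 0 c)) (sphere 0 c - {- x})"
    by (intro openin_delete) auto
  moreover have "(sphere 0 c - {- x}) homeomorphic T"
  proof (rule homeomorphic_punctured_sphere_affine [OF assms])
    show "- x \<in> sphere 0 c" using x by simp
    show "affine T" using T by (simp add: subspace_imp_affine)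
    show "aff_dim T + 1 = int DIM('a)"
      using T by (simp add: aff_dim_subspace of_nat_diff)
  qed
  ultimately show "\<exists>U T :: 'a set. openin (top_of_set (sphere 0 c)) U \<and> x \<in> U \<and>
      subspace T \<and> dim T = DIM('a) - 1 \<and> U homeomorphic T"
    using x T by blast
qed

lemma sphere_null_set: "sphere a c \<in> null_sets lborel"
  using negligible_sphere [of a c]
  by (simp add: negligible_iff_null_sets null_sets_completion_iff)

lemma singular_of_rank_on_sphere_c:
  fixes N :: "(real^'k) measure"
  assumes "c > 0" "sets N = sets borel" "prob_space N" "AE x in N. x \<in> sphere_c c"
  shows "singular_of_rank_on (CARD('k) - 1) (sphere_c c) N"
  using assms locally_euclidean_sphere [OF \<open>c > 0\<close>, where ?'a = "real^'k"] sphere_null_set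
  by (simp add: singular_of_rank_on_def sphere_c_eq_sphere)

section \<open>Minimizers of the residual sum of squares\<close>

lemma inj_gram_matrix:
  fixes X :: "real^'k^'n"
  assumes "inj ((*v) X)"
  shows "inj ((*v) (transpose X ** X))"
proof -
  have "v = 0" if "(transpose X ** X) *v v = 0" for v
  proof -
    have "(X *v v) \<bullet> (X *v v) = ((X *v v) v* X) \<bullet> v"
      by (simp only: dot_lmul_matrix)
    also have "\<dots> = ((transpose X ** X) *v v) \<bullet> v"
      by (simp flip: matrix_vector_mul_assoc)
    finally have "X *v v = X *v 0"
      using that by simp
    then show "v = 0"
      by (rule injD [OF assms])
  qed
  then show ?thesis
    by (simp add: linear_injective_0 [OF matrix_vector_mul_linear])
qed

lemma ols_normal_equations:
  fixes X :: "real^'k^'n"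
  assumes "inj ((*v) X)"
  shows "transpose X *v (X *v ols X y) = transpose X *v y"
proof -
  let ?G = "transpose X ** X"
  have "\<exists>B. ?G ** B = mat 1 \<and> B ** ?G = mat 1"
    using inj_gram_matrix [OF assms]
    by (metis matrix_left_invertible_injective matrix_left_right_inverse)
  then have "?G ** matrix_inv ?G = mat 1"
    unfolding matrix_inv_def by (rule someI2_ex) simp
  then show ?thesis
    by (simp add: ols_def matrix_vector_mul_assoc matrix_mul_assoc del: transpose_matrix_vector)
qed

text \<open>
  Pythagoras: by the normal equations the least squares residual is orthogonal to the range
  of \<open>X\<close>.
\<close>

lemma rss_eq_rss_ols_plus:
  fixes X :: "real^'k^'n"
  assumes "inj ((*v) X)"
  shows "rss X y b = rss X y (ols X y) + (norm (X *v (b - ols X y)))\<^sup>2"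
proof -
  define r where "r = y - X *v ols X y"
  define v where "v = b - ols X y"
  have "r v* X = 0"
    using ols_normal_equations [OF assms, of y]
    by (simp add: r_def matrix_vector_mult_diff_distrib flip: transpose_matrix_vector
        del: transpose_matrix_vector)
  then have "r \<bullet> (X *v v) = 0"
    by (simp flip: dot_lmul_matrix)
  moreover have "y - X *v b = r - X *v v"
    by (simp add: r_def v_def matrix_vector_mult_diff_distrib)
  ultimately show ?thesis
    by (simp add: rss_def flip: r_def v_def)
      (simp add: inner_diff_left inner_diff_right inner_commute power2_norm_eq_inner)
qed

lemma rss_ols_le:
  fixes X :: "real^'k^'n"
  assumes "inj ((*v) X)"
  shows "rss X y (ols X y) \<le> rss X y b"
  by (simp add: rss_eq_rss_ols_plus [OF assms, of y b])

text \<open>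
  By the parallelogram law, the midpoint of two distinct minimizers would have a smaller residual
  sum of squares than both.
\<close>

lemma rss_minimizer_unique:
  fixes X :: "real^'k^'n"
  assumes inj: "inj ((*v) X)"
    and conv: "convex {u. P u}"
    and min: "is_arg_min (rss X y) P b" "is_arg_min (rss X y) P b'"
  shows "b = b'"
proof -
  define m where "m = (1/2) *\<^sub>R b + (1/2) *\<^sub>R b'"
  have "P b" "P b'"
    using min by (auto simp: is_arg_min_def)
  then have "P m"
    using convexD [OF conv, of b b' "1/2" "1/2"] by (simp add: m_def)
  then have le: "rss X y b \<le> rss X y m" "rss X y b' \<le> rss X y m"
    using min by (auto simp: is_arg_min_def not_less)
  define r r' where "r = y - X *v b" and "r' = y - X *v b'"
  have rm: "y - X *v m = (1/2) *\<^sub>R (r + r')"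
    by (simp add: m_def r_def r'_def matrix_vector_right_distrib matrix_vector_mult_scaleR
        vec_eq_iff field_simps)
  have "4 * rss X y m + (r - r') \<bullet> (r - r') = 2 * rss X y b + 2 * rss X y b'"
    unfolding rss_def rm r_def [symmetric] r'_def [symmetric]
    by (simp add: inner_simps inner_commute field_simps)
  then have "(r - r') \<bullet> (r - r') \<le> 0"
    using le by linarith
  then have "r = r'"
    by (metis inner_gt_zero_iff not_less right_minus_eq)
  then show ?thesis
    using inj by (simp add: r_def r'_def inj_eq)
qed

lemma is_arg_min_if_le:
  fixes f :: "'a \<Rightarrow> 'b::linorder"
  assumes "is_arg_min f P x" "P y" "f y \<le> f x"
  shows "is_arg_min f P y"
  using assms by (auto simp: is_arg_min_def not_less intro: order_trans)

text \<open>
  The segment from an interior minimizer to the least squares estimator crosses the sphere.  The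
  crossing point would be a second minimizer, since the residual sum of squares is no larger there.
\<close>

lemma ball_minimizer_on_sphere:
  fixes X :: "real^'k^'n"
  assumes inj: "inj ((*v) X)" and c: "c > 0"
    and min: "is_arg_min (rss X y) (\<lambda>u. u \<bullet> u \<le> c\<^sup>2) b"
    and out: "ols X y \<bullet> ols X y \<ge> c\<^sup>2"
  shows "b \<bullet> b = c\<^sup>2"
proof (rule ccontr)
  assume "b \<bullet> b \<noteq> c\<^sup>2"
  let ?L = "ols X y"
  have "norm b < c"
    using \<open>b \<bullet> b \<noteq> c\<^sup>2\<close> min c
    by (auto simp: is_arg_min_def inner_self_le_square_iff inner_self_eq_square_iff)
  moreover have "?L \<notin> ball 0 c"
    using out c inner_self_less_square_iff [OF c, of ?L] by auto
  ultimately have "closed_segment b ?L \<inter> frontier (ball 0 c) \<noteq> {}"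
    by (intro connected_Int_frontier) auto
  then obtain z where z: "z \<in> closed_segment b ?L" "norm z = c"
    using frontier_ball [OF c, of "0 :: real^'k"] by (metis disjoint_iff mem_sphere_0)
  then obtain t where t: "0 \<le> t" "t \<le> 1" "z = (1 - t) *\<^sub>R b + t *\<^sub>R ?L"
    by (auto simp: closed_segment_def)
  have "z - ?L = (1 - t) *\<^sub>R (b - ?L)"
    by (simp add: t algebra_simps)
  then have "norm (X *v (z - ?L)) = (1 - t) * norm (X *v (b - ?L))"
    using t by (simp add: matrix_vector_mult_scaleR)
  also have "\<dots> \<le> norm (X *v (b - ?L))"
    using t by (simp add: mult_left_le_one_le)
  finally have "rss X y z \<le> rss X y b"
    by (simp add: rss_eq_rss_ols_plus [OF inj, of y z] rss_eq_rss_ols_plus [OF inj, of y b])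
  moreover have "z \<bullet> z \<le> c\<^sup>2"
    using z c by (simp add: inner_self_le_square_iff)
  ultimately have "is_arg_min (rss X y) (\<lambda>u. u \<bullet> u \<le> c\<^sup>2) z"
    using min is_arg_min_if_le by metis
  moreover have "{u :: real^'k. u \<bullet> u \<le> c\<^sup>2} = cball 0 c"
    using c by (auto simp: inner_self_le_square_iff)
  ultimately have "z = b"
    using rss_minimizer_unique [OF inj _ _ min] by simp
  then show False
    using z \<open>norm b < c\<close> by simp
qed

lemma ball_minimizer_cases:
  fixes X :: "real^'k^'n"
  assumes inj: "inj ((*v) X)" and c: "c > 0"
    and min: "is_arg_min (rss X y) (\<lambda>u. u \<bullet> u \<le> c\<^sup>2) b"
    and minS: "is_arg_min (rss X y) (\<lambda>u. u \<bullet> u = c\<^sup>2) bs"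
  shows "b = (if ols X y \<bullet> ols X y < c\<^sup>2 then ols X y else bs)"
proof -
  have "convex {u :: real^'k. u \<bullet> u \<le> c\<^sup>2}"
  proof -
    have "{u :: real^'k. u \<bullet> u \<le> c\<^sup>2} = cball 0 c"
      using c by (auto simp: inner_self_le_square_iff)
    then show ?thesis by simp
  qed
  note unique = rss_minimizer_unique [OF inj this min]
  show ?thesis
  proof (cases "ols X y \<bullet> ols X y < c\<^sup>2")
    case True
    then have "is_arg_min (rss X y) (\<lambda>u. u \<bullet> u \<le> c\<^sup>2) (ols X y)"
      by (intro is_arg_min_if_le [OF min] rss_ols_le [OF inj]) simp
    then show ?thesis
      using unique True by simp
  next
    case False
    then have "b \<bullet> b = c\<^sup>2"
      using ball_minimizer_on_sphere [OF inj c min] by simp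
    then have "rss X y bs \<le> rss X y b" "bs \<bullet> bs \<le> c\<^sup>2"
      using minS by (auto simp: is_arg_min_def not_less)
    then have "is_arg_min (rss X y) (\<lambda>u. u \<bullet> u \<le> c\<^sup>2) bs"
      by (intro is_arg_min_if_le [OF min])
    then show ?thesis
      using unique False by simp
  qed
qed

section \<open>Conditional laws and their mixture\<close>

context prob_space
begin

lemma prob_space_cond_law:
  assumes "Z \<in> borel_measurable M" "prob {w \<in> space M. P w} > 0"
  shows "prob_space (cond_law M Z P)"
  unfolding cond_law_def
proof (rule prob_space.prob_space_distr)
  show "prob_space (uniform_measure M {w \<in> space M. P w})"
    using assms by (intro prob_space_uniform_measure) (auto simp: emeasure_eq_measure)
qed (use assms in simp)

lemma measure_cond_law:
  assumes "Z \<in> borel_measurable M" "prob {w \<in> space M. P w} > 0" "A \<in> sets borel"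
  shows "measure (cond_law M Z P) A
    = prob {w \<in> space M. P w \<and> Z w \<in> A} / prob {w \<in> space M. P w}"
proof -
  have "Z -` A \<inter> space M \<in> sets M"
    using assms by simp
  then have "measure (cond_law M Z P) A
      = prob ({w \<in> space M. P w} \<inter> (Z -` A \<inter> space M)) / prob {w \<in> space M. P w}"
    using assms by (simp add: cond_law_def measure_distr emeasure_eq_measure)
  also have "{w \<in> space M. P w} \<inter> (Z -` A \<inter> space M) = {w \<in> space M. P w \<and> Z w \<in> A}"
    by auto
  finally show ?thesis .
qed

lemma AE_cond_law:
  assumes Z: "Z \<in> borel_measurable M" and P: "{w \<in> space M. P w} \<in> sets M"
    and A: "A \<in> sets borel" "\<And>w. w \<in> space M \<Longrightarrow> P w \<Longrightarrow> Z w \<in> A"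
  shows "AE x in cond_law M Z P. x \<in> A"
proof -
  have "AE w in uniform_measure M {w \<in> space M. P w}. Z w \<in> A"
    using A(2) P by (intro AE_uniform_measureI) auto
  then show ?thesis
    unfolding cond_law_def using Z A(1) by (subst AE_distr_iff) simp_all
qed

text \<open>
  Total probability along the event \<open>P\<close> on which the two definitions are glued.
\<close>

lemma measure_law_piecewise:
  assumes Z: "Z1 \<in> borel_measurable M" "Z2 \<in> borel_measurable M"
    and P [measurable]: "Measurable.pred M P"
    and pos: "prob {w \<in> space M. P w} > 0" "prob {w \<in> space M. \<not> P w} > 0"
    and A: "A \<in> sets borel"
  shows "measure (law M (\<lambda>w. if P w then Z1 w else Z2 w)) A
    = prob {w \<in> space M. P w} * measure (cond_law M Z1 P) A
      + prob {w \<in> space M. \<not> P w} * measure (cond_law M Z2 (\<lambda>w. \<not> P w)) A"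
proof -
  note [measurable] = Z A
  let ?Z = "\<lambda>w. if P w then Z1 w else Z2 w"
  have "measure (law M ?Z) A = prob (?Z -` A \<inter> space M)"
    unfolding law_def by (rule measure_distr) measurable
  also have "?Z -` A \<inter> space M
      = {w \<in> space M. P w \<and> Z1 w \<in> A} \<union> {w \<in> space M. \<not> P w \<and> Z2 w \<in> A}"
    by (auto split: if_splits)
  also have "prob \<dots> = prob {w \<in> space M. P w \<and> Z1 w \<in> A} + prob {w \<in> space M. \<not> P w \<and> Z2 w \<in> A}"
    by (rule finite_measure_Union) (measurable, auto)
  finally show ?thesis
    using pos by (simp add: measure_cond_law [OF Z(1) pos(1) A] measure_cond_law [OF Z(2) pos(2) A])
qed

end

section \<open>The law of the inequality-constrained estimator\<close>

lemma continuous_on_ols: "continuous_on UNIV (ols X)"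
  unfolding ols_def
  by (intro continuous_on_compose2 [OF linear_continuous_on [OF matrix_vector_mul_bounded_linear]]
      linear_continuous_on [OF matrix_vector_mul_bounded_linear]) auto

theorem theorem1:
  fixes M :: "'w measure"
    and X :: "real^'k^'n"
    and beta :: "real^'k"
    and eps Y :: "'w \<Rightarrow> real^'n"
    and s2 c :: real
    and bL bc b0 :: "'w \<Rightarrow> real^'k"
    and lam :: "'w \<Rightarrow> real"
    and mu mu0 muS muB :: "(real^'k) measure"
  assumes "prob_space M"
    and "CARD('k) \<le> CARD('n)"
    and "rank X = CARD('k)"
    and "homoscedastic_errors M eps s2"
    and "\<And>w. Y w = X *v beta + eps w"
    and "c > 0"
    and "\<And>w. bL w = ols X (Y w)"
    and "bc \<in> borel_measurable M"
    and "\<And>w. w \<in> space M \<Longrightarrow> constrained_solution X (Y w) c (bc w) (lam w)"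
    and "\<And>w. w \<in> space M \<Longrightarrow> is_arg_min (rss X (Y w)) (\<lambda>b. b \<bullet> b \<le> c\<^sup>2) (b0 w)"
    and "mu = law M bL"
    and "mu0 = law M b0"
    and "muB = interior_law M bL c"
    and "muS = boundary_law M bL bc c"
  shows "singular_of_rank_on (CARD('k) - 1) (sphere_c c) (law M bc) \<and>
    (measure M {w \<in> space M. bL w \<bullet> bL w < c\<^sup>2} > 0 \<and>
     measure M {w \<in> space M. bL w \<bullet> bL w \<ge> c\<^sup>2} > 0 \<longrightarrow>
       singular_of_rank_on (CARD('k) - 1) (sphere_c c) muS \<and>
       prob_space mu0 \<and>
       prob_space muB \<and> (AE x in muB. x \<in> ball_c c) \<and>
       (\<exists>\<alpha> \<alpha>'. 0 < \<alpha> \<and> \<alpha> < 1 \<and> \<alpha> = 1 - \<alpha>' \<and>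
          (\<forall>A\<in>sets borel. measure mu0 A = \<alpha> * measure muB A + \<alpha>' * measure muS A) \<and>
          (\<forall>A\<in>sets borel. measure muB A =
             inverse (measure mu (ball_c c)) * (LINT t:A|mu. indicator (ball_c c) t)) \<and>
          \<alpha> = measure mu (ball_c c)))"
proof -
  interpret prob_space M by fact
  note c = \<open>c > 0\<close>
  have inj: "inj ((*v) X)"
    using \<open>rank X = CARD('k)\<close> by (simp add: full_rank_injective)
  have [measurable]: "eps \<in> borel_measurable M"
    using \<open>homoscedastic_errors M eps s2\<close> by (simp add: homoscedastic_errors_def)
  have "(\<lambda>w. ols X (X *v beta + eps w)) \<in> borel_measurable M"
    by (rule measurable_compose [OF _ borel_measurable_continuous_onI [OF continuous_on_ols]])
      measurable
  then have bL [measurable]: "bL \<in> borel_measurable M"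
    using assms(5,7) by (simp cong: measurable_cong)
  note bc [measurable] = \<open>bc \<in> borel_measurable M\<close>
  have ball [measurable]: "(ball_c c :: (real^'k) set) \<in> sets borel"
    and sphere [measurable]: "(sphere_c c :: (real^'k) set) \<in> sets borel"
    using c by (simp_all add: ball_c_eq_ball sphere_c_eq_sphere borel_closed)
  have bc_sphere: "bc w \<in> sphere_c c" if "w \<in> space M" for w
    using assms(9) [OF that] by (simp add: constrained_solution_def sphere_c_def)

  have part1: "singular_of_rank_on (CARD('k) - 1) (sphere_c c) (law M bc)"
  proof (rule singular_of_rank_on_sphere_c [OF c])
    show "AE x in law M bc. x \<in> sphere_c c"
      unfolding law_def using bc_sphere by (subst AE_distr_iff) simp_all
  qed (simp_all add: law_def prob_space_distr)

  have b0_eq: "b0 w = (if bL w \<bullet> bL w < c\<^sup>2 then bL w else bc w)" if "w \<in> space M" for w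
    using ball_minimizer_cases [OF inj c assms(10) [OF that], of "bc w"] assms(9) [OF that]
    by (simp add: constrained_solution_def assms(7))
  have mu0: "mu0 = law M (\<lambda>w. if bL w \<bullet> bL w < c\<^sup>2 then bL w else bc w)"
    unfolding \<open>mu0 = law M b0\<close> law_def by (intro distr_cong) (simp_all add: b0_eq)

  let ?a = "prob {w \<in> space M. bL w \<bullet> bL w < c\<^sup>2}"
  let ?a' = "prob {w \<in> space M. bL w \<bullet> bL w \<ge> c\<^sup>2}"
  have mu: "measure mu A = prob {w \<in> space M. bL w \<in> A}" if "A \<in> sets borel" for A
    using that by (simp add: \<open>mu = law M bL\<close> law_def measure_distr vimage_def Int_def conj_commute)
  have mu_ball: "measure mu (ball_c c) = ?a"
    using mu [OF ball] by (simp add: ball_c_def)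

  have part2: "singular_of_rank_on (CARD('k) - 1) (sphere_c c) muS \<and>
       prob_space mu0 \<and>
       prob_space muB \<and> (AE x in muB. x \<in> ball_c c) \<and>
       (\<exists>\<alpha> \<alpha>'. 0 < \<alpha> \<and> \<alpha> < 1 \<and> \<alpha> = 1 - \<alpha>' \<and>
          (\<forall>A\<in>sets borel. measure mu0 A = \<alpha> * measure muB A + \<alpha>' * measure muS A) \<and>
          (\<forall>A\<in>sets borel. measure muB A =
             inverse (measure mu (ball_c c)) * (LINT t:A|mu. indicator (ball_c c) t)) \<and>
          \<alpha> = measure mu (ball_c c))"
    if pos: "?a > 0" "?a' > 0"
  proof (intro conjI exI ballI)
    show "singular_of_rank_on (CARD('k) - 1) (sphere_c c) muS"
    proof (rule singular_of_rank_on_sphere_c [OF c])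
      show "AE x in muS. x \<in> sphere_c c"
        unfolding \<open>muS = _\<close> boundary_law_def using bc_sphere by (intro AE_cond_law) simp_all
      show "prob_space muS"
        unfolding \<open>muS = _\<close> boundary_law_def using pos by (intro prob_space_cond_law) simp_all
    qed (simp add: \<open>muS = _\<close> boundary_law_def cond_law_def)
    show "prob_space mu0"
      unfolding mu0 law_def by (rule prob_space_distr) measurable
    show "prob_space muB"
      unfolding \<open>muB = _\<close> interior_law_def using pos by (intro prob_space_cond_law) simp_all
    show "AE x in muB. x \<in> ball_c c"
      unfolding \<open>muB = _\<close> interior_law_def by (intro AE_cond_law) (simp_all add: ball_c_def)
    show "0 < ?a" by fact
    have "{w \<in> space M. \<not> bL w \<bullet> bL w < c\<^sup>2} = {w \<in> space M. bL w \<bullet> bL w \<ge> c\<^sup>2}"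
      by auto
    moreover have "prob {w \<in> space M. \<not> bL w \<bullet> bL w < c\<^sup>2} = 1 - ?a"
      by (rule prob_neg) measurable
    ultimately show compl: "?a = 1 - ?a'"
      by simp
    then show "?a < 1"
      using pos by simp
    show "?a = measure mu (ball_c c)"
      by (simp add: mu_ball)
  next
    fix A :: "(real^'k) set"
    assume A [measurable]: "A \<in> sets borel"
    show "measure mu0 A = ?a * measure muB A + ?a' * measure muS A"
      using measure_law_piecewise [OF bL bc _ _ _ A, of "\<lambda>w. bL w \<bullet> bL w < c\<^sup>2"] pos
      by (simp add: mu0 \<open>muB = _\<close> \<open>muS = _\<close> interior_law_def boundary_law_def not_less)
    interpret mu: prob_space mu
      unfolding \<open>mu = law M bL\<close> law_def by (rule prob_space_distr) measurable
    have sets_mu: "sets mu = sets borel"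
      by (simp add: \<open>mu = law M bL\<close> law_def)
    have "(LINT t:A|mu. indicator (ball_c c) t) = (LINT t|mu. indicat_real (A \<inter> ball_c c) t)"
      by (simp add: set_lebesgue_integral_def indicator_inter_arith)
    also have "\<dots> = measure mu (A \<inter> ball_c c)"
      using sets_eq_imp_space_eq [OF sets_mu] by simp
    also have "\<dots> = prob {w \<in> space M. bL w \<bullet> bL w < c\<^sup>2 \<and> bL w \<in> A}"
      by (subst mu) (auto simp: ball_c_def conj_commute)
    finally show "measure muB A =
        inverse (measure mu (ball_c c)) * (LINT t:A|mu. indicator (ball_c c) t)"
      unfolding mu_ball \<open>muB = _\<close> interior_law_def
      by (simp add: measure_cond_law [OF bL pos(1) A] field_simps)
  qed
  show ?thesis
    using part1 part2 by blast
qed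

end
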